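(* Let $\{\varphi_e\}_{e\in E}$ be a family of set functions $\varphi_e:\mathcal{B}\to[0,\infty)$ with $\varphi_e(J)=\varphi_e(\varnothing)=0$, and let $\mathcal{Y}\subset 2^{\mathrm{Bd}}$ be an admissible set family. Let $p,q,s,t\ge 1$ with $ps'=qt'$, where $s'$ and $t'$ are the Hölder conjugates of $s$ and $t$. Then $$c(\Phi_p,\llbracket\cdot\rrbracket_q)\le t\cdot c(\Phi_{ps},\llbracket\cdot\rrbracket_{qt}).$$ In particular, $p\mapsto p\cdot c(\Phi_p,\llbracket\cdot\rrbracket_p)$ is increasing on $[1,\infty)$. In addition (for $0<\eta(E)<\infty$), $p\mapsto\eta(E)^{-1/p}c(\Phi_p,\llbracket\cdot\rrbracket_q)$ is increasing for each fixed $q\ge1$, and $q\mapsto\eta(E)^{1/q}c(\Phi_p,\llbracket\cdot\rrbracket_q)$ is decreasing for each fixed $p\ge1$. Moreover, let $\{\psi_e\}_{e\in E}$ be a family of set-pair functions $\psi_e:\mathcal{B}\times\mathcal{B}\to[0,\infty)$ with $\psi_e(\varnothing,\varnothing)=0$, and let $\llbracket\cdot\rrbracket$ now denote its set-pair version. Then, for $p,q,s,t\ge1$ with $ps'=qt'$, $$c(\Psi_p,\llbracket\cdot\rrbracket_q)\le t\cdot c(\Psi_{ps},\llbracket\cdot\rrbracket_{qt});$$ in particular, $p\mapsto p\cdot c(\Psi_p,\llbracket\cdot\rrbracket_p)$ is increasing on $[1,\infty)$; and (for $0<\eta(E)<\infty$) $p\mapsto\eta(E)^{-1/p}c(\Psi_p,\llbracket\cdot\rrbracket_q)$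 is increasing for each fixed $q\ge1$, and $q\mapsto\eta(E)^{1/q}c(\Psi_p,\llbracket\cdot\rrbracket_q)$ is decreasing for each fixed $p\ge1$.
   Context: $(J,\mathcal{B})$ is a measurable space, $\mathrm{Bd}$ is the space of bounded measurable functions $f:J\to\mathbb{R}$, and $(E,\eta)$ is a measure space. "Increasing/decreasing" are in the weak sense. The Hölder conjugate of $1$ is $\infty$. For set functions: $\widehat{\varphi}_e(f)=\int_{\inf f}^\infty\varphi_e\{f\ge t\}\,dt+\varphi_e(J)\inf f$ (Choquet extension), $\Phi_p(f)=\big(\int_E(\widehat{\varphi}_e(f))^p\,d\eta(e)\big)^{1/p}$, $|f|_{\varphi_e}=\inf\{t>0:\varphi_e\{f\ge s\}=\varphi_e\{f\ge -s\}=0\ \forall s\ge t\}$, and $\llbracket f\rrbracket_p=\big(\int_E|f|_{\varphi_e}^p\,d\eta(e)\big)^{1/p}$. For set-pair functions: $\widehat{\psi}_e(f)=\int_0^\infty\psi_e(\{f\ge t\},\{f\le -t\})\,dt$, $\Psi_p(f)=\big(\int_E(\widehat{\psi}_e(f))^p\,d\eta(e)\big)^{1/p}$, $\|f\|_{\psi_e}=\inf\{t>0:\psi_e(\{f\ge s\},\{f\le -s\})=0\ \forall s\ge t\}$, and the set-pair version of the norm is $\llbracket f\rrbracket_q=\big(\int_E\|f\|_{\psi_e}^q\,d\eta(e)\big)^{1/q}$. It is assumed that $t\mapsto\varphi_e\{f\ge t\}$ (resp. $t\mapsto\psi_e(\{f\ge t\},\{f\le -t\})$) is Lebesgue integrable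 on $[\inf f,\infty)$ (resp. $(0,\infty)$) for all $f\in\mathrm{Bd}$, and that the integrands over $E$ are measurable. For $r>0$ the Mazur map is $f^r(x)=|f(x)|^r\,\mathrm{sign}(f(x))$. A family $\mathcal{Y}\subset 2^{\mathrm{Bd}}$ is admissible if $Y\in\mathcal{Y}$ implies $\{f^r:f\in Y\}\in\mathcal{Y}$ for every $r>0$. The global extension constants are $$c(\Phi_p,\llbracket\cdot\rrbracket_q)=\inf_{Y\in\mathcal{Y}}\sup_{f\in Y}\frac{\Phi_p(f)}{\llbracket f\rrbracket_q},\qquad c(\Psi_p,\llbracket\cdot\rrbracket_q)=\inf_{Y\in\mathcal{Y}}\sup_{f\in Y}\frac{\Psi_p(f)}{\llbracket f\rrbracket_q},$$ where the supremum is over those $f\in Y$ with $0<\llbracket f\rrbracket_q<\infty$, and sets $Y$ containing no such $f$ are discarded. *)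

theory Defs
  imports "HOL-Analysis.Analysis"
begin

text \<open>The measurable space J is given by a measure \<open>M\<close>, of which only \<open>space M\<close> and \<open>sets M\<close> are
  used. Functions on J are represented by extensional functions, so that two of them are equal iff
  they agree on J.\<close>

definition Bd :: "'a measure \<Rightarrow> ('a \<Rightarrow> real) set" where
  "Bd M = {f \<in> borel_measurable M. f \<in> extensional (space M) \<and> bounded (f ` space M)}"

definition superlevel :: "'a measure \<Rightarrow> ('a \<Rightarrow> real) \<Rightarrow> real \<Rightarrow> 'a set" where
  "superlevel M f t = {x \<in> space M. f x \<ge> t}"

definition sublevel :: "'a measure \<Rightarrow> ('a \<Rightarrow> real) \<Rightarrow> real \<Rightarrow> 'a set" where
  "sublevel M f t = {x \<in> space M. f x \<le> t}"

definition mazur :: "'a measure \<Rightarrow> real \<Rightarrow> ('a \<Rightarrow> real) \<Rightarrow> 'a \<Rightarrow> real" where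
  "mazur M r f = (\<lambda>x\<in>space M. \<bar>f x\<bar> powr r * sgn (f x))"

definition admissible :: "'a measure \<Rightarrow> ('a \<Rightarrow> real) set set \<Rightarrow> bool" where
  "admissible M \<Y> \<longleftrightarrow> \<Y> \<subseteq> Pow (Bd M) \<and> (\<forall>Y\<in>\<Y>. \<forall>r>0. mazur M r ` Y \<in> \<Y>)"

definition choquet :: "'a measure \<Rightarrow> ('a set \<Rightarrow> real) \<Rightarrow> ('a \<Rightarrow> real) \<Rightarrow> real" where
  "choquet M \<phi> f =
     (LINT t:{Inf (f ` space M)..}|lebesgue. \<phi> (superlevel M f t))
     + \<phi> (space M) * Inf (f ` space M)"

text \<open>If \<open>\<phi>\<close> vanishes on the empty set and on the whole space and \<open>f\<close> is bounded, then the set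
  below contains every \<open>t > sup |f|\<close>, so the real infimum is the intended one. Likewise for
  \<open>pair_norm\<close>.\<close>

definition set_norm :: "'a measure \<Rightarrow> ('a set \<Rightarrow> real) \<Rightarrow> ('a \<Rightarrow> real) \<Rightarrow> real" where
  "set_norm M \<phi> f =
     Inf {t. 0 < t \<and> (\<forall>s\<ge>t. \<phi> (superlevel M f s) = 0 \<and> \<phi> (superlevel M f (- s)) = 0)}"

definition pair_ext :: "'a measure \<Rightarrow> ('a set \<Rightarrow> 'a set \<Rightarrow> real) \<Rightarrow> ('a \<Rightarrow> real) \<Rightarrow> real" where
  "pair_ext M \<psi> f = (LINT t:{0<..}|lebesgue. \<psi> (superlevel M f t) (sublevel M f (- t)))"

definition pair_norm :: "'a measure \<Rightarrow> ('a set \<Rightarrow> 'a set \<Rightarrow> real) \<Rightarrow> ('a \<Rightarrow> real) \<Rightarrow> real" where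
  "pair_norm M \<psi> f =
     Inf {t. 0 < t \<and> (\<forall>s\<ge>t. \<psi> (superlevel M f s) (sublevel M f (- s)) = 0)}"

text \<open>Power of an extended nonnegative real, used for positive exponents only.\<close>

definition ennreal_rpow :: "ennreal \<Rightarrow> real \<Rightarrow> ennreal" where
  "ennreal_rpow x a = (if x = \<infinity> then \<infinity> else ennreal (enn2real x powr a))"

definition Lp_functional :: "'e measure \<Rightarrow> real \<Rightarrow> ('e \<Rightarrow> real) \<Rightarrow> ennreal" where
  "Lp_functional \<eta> p g = ennreal_rpow (\<integral>\<^sup>+ e. ennreal (g e powr p) \<partial>\<eta>) (1 / p)"

definition Phi ::
  "'a measure \<Rightarrow> 'e measure \<Rightarrow> ('e \<Rightarrow> 'a set \<Rightarrow> real) \<Rightarrow> real \<Rightarrow> ('a \<Rightarrow> real) \<Rightarrow> ennreal" where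
  "Phi M \<eta> \<phi> p f = Lp_functional \<eta> p (\<lambda>e. choquet M (\<phi> e) f)"

definition set_bracket ::
  "'a measure \<Rightarrow> 'e measure \<Rightarrow> ('e \<Rightarrow> 'a set \<Rightarrow> real) \<Rightarrow> real \<Rightarrow> ('a \<Rightarrow> real) \<Rightarrow> ennreal" where
  "set_bracket M \<eta> \<phi> q f = Lp_functional \<eta> q (\<lambda>e. set_norm M (\<phi> e) f)"

definition Psi ::
  "'a measure \<Rightarrow> 'e measure \<Rightarrow> ('e \<Rightarrow> 'a set \<Rightarrow> 'a set \<Rightarrow> real) \<Rightarrow> real \<Rightarrow> ('a \<Rightarrow> real) \<Rightarrow> ennreal" where
  "Psi M \<eta> \<psi> p f = Lp_functional \<eta> p (\<lambda>e. pair_ext M (\<psi> e) f)"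

definition pair_bracket ::
  "'a measure \<Rightarrow> 'e measure \<Rightarrow> ('e \<Rightarrow> 'a set \<Rightarrow> 'a set \<Rightarrow> real) \<Rightarrow> real \<Rightarrow> ('a \<Rightarrow> real) \<Rightarrow> ennreal" where
  "pair_bracket M \<eta> \<psi> q f = Lp_functional \<eta> q (\<lambda>e. pair_norm M (\<psi> e) f)"

text \<open>The second condition on \<open>Y\<close> discards the sets without any \<open>f\<close> to take the supremum over. If
  every \<open>Y\<close> is discarded, the constant is \<open>\<infinity>\<close>.\<close>

definition ext_const ::
  "('a \<Rightarrow> real) set set \<Rightarrow> (('a \<Rightarrow> real) \<Rightarrow> ennreal) \<Rightarrow> (('a \<Rightarrow> real) \<Rightarrow> ennreal) \<Rightarrow> ennreal" where
  "ext_const \<Y> F N =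
     (INF Y \<in> {Y \<in> \<Y>. \<exists>f\<in>Y. 0 < N f \<and> N f < \<infinity>}. SUP f \<in> {f \<in> Y. 0 < N f \<and> N f < \<infinity>}. F f / N f)"

definition hoelder_conj :: "real \<Rightarrow> ennreal" where
  "hoelder_conj s = (if s = 1 then \<infinity> else ennreal (s / (s - 1)))"

definition set_function_family ::
  "'a measure \<Rightarrow> 'e measure \<Rightarrow> ('e \<Rightarrow> 'a set \<Rightarrow> real) \<Rightarrow> bool" where
  "set_function_family M \<eta> \<phi> \<longleftrightarrow>
     (\<forall>e\<in>space \<eta>. (\<forall>A\<in>sets M. 0 \<le> \<phi> e A) \<and> \<phi> e (space M) = 0 \<and> \<phi> e {} = 0 \<and>
        (\<forall>f\<in>Bd M. set_integrable lebesgue {Inf (f ` space M)..} (\<lambda>t. \<phi> e (superlevel M f t)))) \<and>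
     (\<forall>f\<in>Bd M. (\<lambda>e. choquet M (\<phi> e) f) \<in> borel_measurable \<eta> \<and>
                (\<lambda>e. set_norm M (\<phi> e) f) \<in> borel_measurable \<eta>)"

definition set_pair_function_family ::
  "'a measure \<Rightarrow> 'e measure \<Rightarrow> ('e \<Rightarrow> 'a set \<Rightarrow> 'a set \<Rightarrow> real) \<Rightarrow> bool" where
  "set_pair_function_family M \<eta> \<psi> \<longleftrightarrow>
     (\<forall>e\<in>space \<eta>. (\<forall>A\<in>sets M. \<forall>B\<in>sets M. 0 \<le> \<psi> e A B) \<and> \<psi> e {} {} = 0 \<and>
        (\<forall>f\<in>Bd M. set_integrable lebesgue {0<..}
                     (\<lambda>t. \<psi> e (superlevel M f t) (sublevel M f (- t))))) \<and>
     (\<forall>f\<in>Bd M. (\<lambda>e. pair_ext M (\<psi> e) f) \<in> borel_measurable \<eta> \<and>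
                (\<lambda>e. pair_norm M (\<psi> e) f) \<in> borel_measurable \<eta>)"

end

theory Submission
  imports Defs
begin

text \<open>The level set \<open>{f\<^sup>r \<ge> t}\<close> of a Mazur map is \<open>{f \<ge> u}\<close> with \<open>t = \<bar>u\<bar>\<^sup>r sign u\<close>. Substituting this in the
  Choquet integral gives, for \<open>r \<ge> 1\<close>, an extension of \<open>f\<^sup>r\<close> that is at most \<open>r N\<^sup>r\<^sup>-\<^sup>1\<close> times the extension
  of \<open>f\<close>, where \<open>N\<close> is the norm of \<open>f\<close>, because the integrand vanishes for \<open>\<bar>u\<bar> > N\<close>; moreover \<open>f\<^sup>r\<close> has
  norm \<open>N\<^sup>r\<close>. Hoelder's inequality over the parameter space with exponents \<open>s\<close> and \<open>s'\<close> then bounds the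
  quotient of \<open>f\<^sup>t\<close> at \<open>(p, q)\<close> by \<open>t\<close> times that of \<open>f\<close> at \<open>(p s, q t)\<close>, since \<open>(t - 1) p s' = q t\<close>.\<close>

section \<open>Signed powers on the real line\<close>

text \<open>The scalar form of the Mazur map: on \<open>space M\<close>, \<open>mazur M r f\<close>
  is \<open>f\<close> followed by \<open>spow r\<close>. It is kept separate because it also acts on
  the levels at which \<open>f\<close> is cut.\<close>

definition spow :: "real \<Rightarrow> real \<Rightarrow> real" where
  "spow r u = \<bar>u\<bar> powr r * sgn u"

lemma spow_nonneg [simp]: "0 \<le> u \<Longrightarrow> spow r u = u powr r"
  by (cases "u = 0") (auto simp: spow_def)

lemma spow_minus [simp]: "spow r (- u) = - spow r u"
  by (simp add: spow_def sgn_minus)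

lemma strict_mono_spow:
  assumes "0 < r"
  shows "strict_mono (spow r)"
proof (rule strict_monoI)
  fix x y :: real
  assume xy: "x < y"
  consider "0 \<le> x" | "x < 0" "0 \<le> y" | "y < 0" by linarith
  then show "spow r x < spow r y"
  proof cases
    case 1
    then show ?thesis using xy assms by (auto intro: powr_less_mono2)
  next
    case 2
    have "spow r x < 0" using 2 by (simp add: spow_def)
    also have "0 \<le> spow r y" using 2 by simp
    finally show ?thesis .
  next
    case 3
    then have "spow r (- y) < spow r (- x)"
      using xy assms by (auto simp del: spow_minus intro!: powr_less_mono2)
    then show ?thesis by simp
  qed
qed

lemma spow_spow_inverse:
  assumes "0 < r"
  shows "spow r (spow (1 / r) u) = u"
proof -
  have "spow r (spow (1 / r) u) = u" if "0 \<le> u" for u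
    using that assms by (simp add: powr_powr)
  from this[of u] this[of "- u"] show ?thesis
    by (cases "0 \<le> u") auto
qed

text \<open>Away from 0 this is the power rule, carried to negative arguments by oddness. At 0 the
  difference quotient is \<open>\<bar>h\<bar> powr (r - 1)\<close>, which tends to 0 because
  \<open>r > 1\<close>.\<close>

lemma has_field_derivative_spow:
  assumes "1 < r"
  shows "(spow r has_field_derivative r * \<bar>u\<bar> powr (r - 1)) (at u within S)"
proof -
  have pos: "(spow r has_field_derivative r * \<bar>u\<bar> powr (r - 1)) (at u)" if "0 < u" for u
  proof (rule has_field_derivative_transform_within_open[of "\<lambda>x. x powr r" _ _ "{0<..}"])
    show "((\<lambda>x. x powr r) has_field_derivative r * \<bar>u\<bar> powr (r - 1)) (at u)"
      using has_real_derivative_powr[OF that, of r] that by simp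
  qed (use that in auto)
  have "(spow r has_field_derivative r * \<bar>u\<bar> powr (r - 1)) (at u)"
  proof (cases u "0 :: real" rule: linorder_cases)
    case less
    have "((\<lambda>x. - spow r (- x)) has_field_derivative - (r * \<bar>- u\<bar> powr (r - 1) * - 1)) (at u)"
      using less by (intro DERIV_minus DERIV_chain2[OF pos]) (auto intro!: derivative_eq_intros)
    then show ?thesis by simp
  next
    case equal
    have "((\<lambda>h. \<bar>h\<bar> powr (r - 1)) \<longlongrightarrow> 0) (at (0::real))"
      using tendsto_powr'[of "\<lambda>h. \<bar>h\<bar>" 0 "at (0::real)" "\<lambda>_. r - 1" "r - 1"] assms
      by (simp add: tendsto_rabs_zero)
    also have "?this \<longleftrightarrow> ((\<lambda>h. (spow r (0 + h) - spow r 0) / h) \<longlongrightarrow> 0) (at (0::real))"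
      by (intro tendsto_cong eventually_mono[OF eventually_neq_at_within[of 0]])
        (auto simp: spow_def powr_diff sgn_if)
    finally show ?thesis using equal by (simp add: DERIV_def)
  next
    case greater
    then show ?thesis by (rule pos)
  qed
  then show ?thesis by (rule has_field_derivative_at_within)
qed

section \<open>Layer functions of one real variable\<close>

text \<open>Common form of \<open>set_norm\<close> and \<open>pair_norm\<close>. In the pair case
  the layer function is continued by 0 to nonpositive levels, which makes the condition at
  \<open>- s\<close> void.\<close>

definition layer_norm :: "(real \<Rightarrow> real) \<Rightarrow> real" where
  "layer_norm H = Inf {t. 0 < t \<and> (\<forall>s\<ge>t. H s = 0 \<and> H (- s) = 0)}"

text \<open>The threshold \<open>T\<close> witnesses that the set under the infimum is nonempty; the
  real \<open>Inf\<close> of the empty set would carry no information.\<close>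

lemma layer_norm_nonneg:
  assumes "0 < T" "\<And>s. T \<le> s \<Longrightarrow> H s = 0 \<and> H (- s) = 0"
  shows "0 \<le> layer_norm H"
  unfolding layer_norm_def using assms by (intro cInf_greatest) auto

lemma layer_norm_le:
  assumes "0 < T" "\<And>s. T \<le> s \<Longrightarrow> H s = 0 \<and> H (- s) = 0"
  shows "layer_norm H \<le> T"
  unfolding layer_norm_def using assms
  by (intro cInf_lower) (auto intro!: bdd_belowI[of _ 0])

text \<open>The infimum need not be attained, but a number strictly above it exceeds some member of
  the set, and from that member on \<open>H\<close> vanishes on both sides of 0.\<close>

lemma layer_vanishes_above_norm:
  assumes "0 < T" "\<And>s. T \<le> s \<Longrightarrow> H s = 0 \<and> H (- s) = 0" and "layer_norm H < \<bar>u\<bar>"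
  shows "H u = 0"
proof -
  let ?S = "{t. 0 < t \<and> (\<forall>s\<ge>t. H s = 0 \<and> H (- s) = 0)}"
  have "T \<in> ?S" using assms(1,2) by blast
  then have "?S \<noteq> {}" by blast
  then obtain t where "t \<in> ?S" "t < \<bar>u\<bar>"
    using assms(3) unfolding layer_norm_def by (rule cInf_lessD[THEN bexE]) auto
  then have "H \<bar>u\<bar> = 0 \<and> H (- \<bar>u\<bar>) = 0" by auto
  then show ?thesis by (cases "0 \<le> u") auto
qed

text \<open>An odd increasing bijection carries the set defining \<open>layer_norm H\<close> onto
  the one defining \<open>layer_norm H'\<close>; being monotone and continuous, it commutes with the
  infimum.\<close>

lemma layer_norm_spow:
  assumes r: "1 < r" and H: "\<And>u. H' (spow r u) = H u"
    and T: "0 < T" "\<And>s. T \<le> s \<Longrightarrow> H s = 0 \<and> H (- s) = 0"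
  shows "layer_norm H' = layer_norm H powr r"
proof -
  have r0: "0 < r" using r by simp
  let ?S = "{t. 0 < t \<and> (\<forall>s\<ge>t. H s = 0 \<and> H (- s) = 0)}"
  let ?S' = "{t. 0 < t \<and> (\<forall>s\<ge>t. H' s = 0 \<and> H' (- s) = 0)}"
  have mem: "spow r t \<in> ?S' \<longleftrightarrow> t \<in> ?S" for t
  proof -
    \<comment> \<open>Surjectivity of \<open>spow r\<close> allows the bound variable to be written
      as \<open>spow r s\<close>.\<close>
    have "(\<forall>s\<ge>spow r t. H' s = 0 \<and> H' (- s) = 0) \<longleftrightarrow>
        (\<forall>s. spow r t \<le> spow r s \<longrightarrow> H' (spow r s) = 0 \<and> H' (- spow r s) = 0)"
      by (metis spow_spow_inverse[OF r0])
    also have "\<dots> \<longleftrightarrow> (\<forall>s\<ge>t. H s = 0 \<and> H (- s) = 0)"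
      unfolding spow_minus[symmetric] H strict_mono_less_eq[OF strict_mono_spow[OF r0]] ..
    finally show ?thesis
      using strict_mono_less[OF strict_mono_spow[OF r0], of 0 t] by simp
  qed
  have "?S' = spow r ` ?S"
  proof (intro equalityI subsetI)
    fix t assume "t \<in> ?S'"
    then have "spow (1 / r) t \<in> ?S" using mem[of "spow (1 / r) t"] unfolding spow_spow_inverse[OF r0] by blast
    then have "spow r (spow (1 / r) t) \<in> spow r ` ?S" by (rule imageI)
    then show "t \<in> spow r ` ?S" unfolding spow_spow_inverse[OF r0] .
  next
    fix t assume "t \<in> spow r ` ?S"
    then show "t \<in> ?S'" using mem by blast
  qed
  moreover have "spow r (Inf ?S) = (INF t\<in>?S. spow r t)"
  proof (rule continuous_at_Inf_mono)
    show "mono (spow r)" using strict_mono_spow[OF r0] by (rule strict_mono_mono)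
    have "T \<in> ?S" using T by blast
    then show "?S \<noteq> {}" by blast
    have "isCont (spow r) x" for x
      using has_field_derivative_spow[OF r] by (rule DERIV_isCont)
    then show "continuous (at_right (Inf ?S)) (spow r)"
      by (rule continuous_at_imp_continuous_at_within)
    show "bdd_below ?S" by (auto intro!: bdd_belowI[of _ 0])
  qed
  ultimately show ?thesis
    using layer_norm_nonneg[of T H] T by (simp add: layer_norm_def)
qed

text \<open>Substitute \<open>t = spow r u\<close> and use that \<open>H\<close> vanishes for \<open>\<bar>u\<bar> > layer_norm H\<close>.\<close>

lemma integral_layer_spow_le:
  assumes r: "1 < r" and H: "\<And>u. H' (spow r u) = H u" and H0: "\<And>u. 0 \<le> H u"
    and T: "0 < T" "\<And>s. T \<le> s \<Longrightarrow> H s = 0 \<and> H (- s) = 0"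
    and int: "H absolutely_integrable_on UNIV" "H' absolutely_integrable_on UNIV"
  shows "integral UNIV H' \<le> r * layer_norm H powr (r - 1) * integral UNIV H"
proof -
  have "surj (spow r)" using spow_spow_inverse[of r] r by (metis surjI less_trans zero_less_one)
  then have *: "(\<lambda>u. \<bar>r * \<bar>u\<bar> powr (r - 1)\<bar> * H' (spow r u)) absolutely_integrable_on UNIV \<and>
      integral UNIV (\<lambda>u. \<bar>r * \<bar>u\<bar> powr (r - 1)\<bar> * H' (spow r u)) = integral UNIV H'"
    using int(2) r
    by (subst has_absolute_integral_change_of_variables_1')
      (auto intro!: has_field_derivative_spow strict_mono_imp_inj_on strict_mono_spow)
  let ?c = "r * layer_norm H powr (r - 1)"
  have "integral UNIV H' = integral UNIV (\<lambda>u. \<bar>r * \<bar>u\<bar> powr (r - 1)\<bar> * H u)"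
    using * H by simp
  also have "\<dots> \<le> integral UNIV (\<lambda>u. ?c * H u)"
  proof (rule integral_le)
    show "(\<lambda>u. \<bar>r * \<bar>u\<bar> powr (r - 1)\<bar> * H u) integrable_on UNIV"
      using conjunct1[OF *] H by (simp add: set_lebesgue_integral_eq_integral(1))
    show "(\<lambda>u. ?c * H u) integrable_on UNIV"
      using set_lebesgue_integral_eq_integral(1)[OF int(1)] by (rule integrable_on_mult_right)
    show "\<bar>r * \<bar>u\<bar> powr (r - 1)\<bar> * H u \<le> ?c * H u" for u
    proof (cases "\<bar>u\<bar> \<le> layer_norm H")
      case True
      then show ?thesis using r H0[of u]
        by (intro mult_right_mono) (auto intro!: powr_mono2)
    next
      case False
      then show ?thesis using layer_vanishes_above_norm[of T H u] T by auto
    qed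
  qed
  also have "\<dots> = ?c * integral UNIV H" by simp
  finally show ?thesis .
qed

section \<open>Powers of extended nonnegative reals\<close>

lemma ennreal_rpow_ennreal: "0 \<le> x \<Longrightarrow> ennreal_rpow (ennreal x) a = ennreal (x powr a)"
  by (simp add: ennreal_rpow_def)

lemma ennreal_rpow_top [simp]: "ennreal_rpow \<infinity> a = \<infinity>" "ennreal_rpow top a = top"
  by (simp_all add: ennreal_rpow_def)

lemma ennreal_rpow_mono: "0 \<le> a \<Longrightarrow> x \<le> y \<Longrightarrow> ennreal_rpow x a \<le> ennreal_rpow y a"
  by (cases x; cases y) (auto simp: ennreal_rpow_ennreal powr_mono2 top_unique)

lemma ennreal_rpow_rpow: "ennreal_rpow (ennreal_rpow x a) b = ennreal_rpow x (a * b)"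
  by (cases x) (auto simp: ennreal_rpow_ennreal powr_powr)

lemma ennreal_rpow_eq_0_iff [simp]: "ennreal_rpow x a = 0 \<longleftrightarrow> x = 0"
  by (cases x) (auto simp: ennreal_rpow_ennreal)

lemma ennreal_rpow_less_top_iff [simp]: "ennreal_rpow x a < top \<longleftrightarrow> x < top"
  by (cases x) (auto simp: ennreal_rpow_ennreal)

text \<open>Valid for exponents of any sign: 0 and \<open>top\<close> are fixed by every power, so
  the convention \<open>0 * top = 0\<close> is respected.\<close>

lemma ennreal_rpow_mult: "ennreal_rpow (x * y) a = ennreal_rpow x a * ennreal_rpow y a"
  by (cases x; cases y)
    (auto simp: ennreal_rpow_ennreal powr_mult ennreal_mult_top ennreal_top_mult
      simp flip: ennreal_mult)

section \<open>Hoelder's inequality and functionals of L^p type\<close>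

text \<open>By the conventions for \<open>powr\<close>, \<open>u x powr p\<close> vanishes only
  where \<open>u x = 0\<close>, whatever the signs of \<open>u x\<close> and
  \<open>p\<close>.\<close>

lemma nn_integral_powr_eq_0_iff:
  assumes [measurable]: "u \<in> borel_measurable M"
  shows "(\<integral>\<^sup>+ x. ennreal (u x powr p) \<partial>M) = 0 \<longleftrightarrow> (AE x in M. u x = 0)"
  by (subst nn_integral_0_iff_AE) (auto simp: ennreal_eq_0_iff powr_nonneg_iff)

text \<open>Young's inequality is applied to \<open>u\<close> and \<open>v\<close> divided by their
  norms, then integrated. If one integral on the right is 0, the product vanishes almost everywhere;
  if both are nonzero and one is infinite, the right-hand side is \<open>top\<close>.\<close>

lemma nn_integral_Hoelder:
  fixes u v :: "'a \<Rightarrow> real"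
  assumes [measurable]: "u \<in> borel_measurable M" "v \<in> borel_measurable M"
    and nonneg: "\<And>x. x \<in> space M \<Longrightarrow> 0 \<le> u x" "\<And>x. x \<in> space M \<Longrightarrow> 0 \<le> v x"
    and s: "1 < s" "1 < s'" "1 / s + 1 / s' = 1"
  shows "(\<integral>\<^sup>+ x. ennreal (u x * v x) \<partial>M) \<le>
    ennreal_rpow (\<integral>\<^sup>+ x. ennreal (u x powr s) \<partial>M) (1 / s) *
    ennreal_rpow (\<integral>\<^sup>+ x. ennreal (v x powr s') \<partial>M) (1 / s')"
    (is "?I \<le> ennreal_rpow ?U _ * ennreal_rpow ?V _")
proof -
  consider "?U = 0 \<or> ?V = 0" | "?U \<noteq> 0" "?V \<noteq> 0" "?U = top \<or> ?V = top"
    | "?U \<noteq> 0" "?V \<noteq> 0" "?U \<noteq> top" "?V \<noteq> top"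
    by blast
  then show ?thesis
  proof cases
    case 1
    then have "AE x in M. u x * v x = 0" by (auto simp: nn_integral_powr_eq_0_iff)
    then have "?I = 0" by (subst nn_integral_0_iff_AE) auto
    then show ?thesis by simp
  next
    case 2
    then show ?thesis by (auto simp: ennreal_mult_top ennreal_top_mult)
  next
    case 3
    obtain a where a: "?U = ennreal a" "0 < a"
      using 3(1,3) by (cases ?U) (auto simp: order_le_less)
    obtain b where b: "?V = ennreal b" "0 < b"
      using 3(2,4) by (cases ?V) (auto simp: order_le_less)
    define \<alpha> where "\<alpha> = a powr (1 / s)"
    define \<beta> where "\<beta> = b powr (1 / s')"
    have pos: "0 < \<alpha>" "0 < \<beta>" using a b by (simp_all add: \<alpha>_def \<beta>_def)
    have pw: "\<alpha> powr s = a" "\<beta> powr s' = b"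
      using a b s by (simp_all add: \<alpha>_def \<beta>_def powr_powr)
    \<comment> \<open>The coefficients are those of Young's inequality for
      \<open>u x / \<alpha>\<close> and \<open>v x / \<beta>\<close>, multiplied by
      \<open>\<alpha> * \<beta>\<close>, with \<open>\<alpha> powr s = a\<close> and
      \<open>\<beta> powr s' = b\<close>.\<close>
    have "?I \<le> (\<integral>\<^sup>+ x. ennreal (\<alpha> * \<beta> / (a * s)) * ennreal (u x powr s) +
        ennreal (\<alpha> * \<beta> / (b * s')) * ennreal (v x powr s') \<partial>M)"
    proof (rule nn_integral_mono)
      fix x assume x: "x \<in> space M"
      have "u x / \<alpha> * (v x / \<beta>) \<le> (u x / \<alpha>) powr s / s + (v x / \<beta>) powr s' / s'"
        using s pos nonneg[OF x] by (intro Youngs_inequality) auto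
      also have "\<dots> = u x powr s / (a * s) + v x powr s' / (b * s')"
        using pos nonneg[OF x] pw by (simp add: powr_divide)
      finally have "u x * v x \<le> \<alpha> * \<beta> * (u x powr s / (a * s) + v x powr s' / (b * s'))"
        using pos by (simp add: divide_le_eq mult.commute)
      also have "\<dots> = \<alpha> * \<beta> / (a * s) * u x powr s + \<alpha> * \<beta> / (b * s') * v x powr s'"
        by (simp add: algebra_simps)
      finally show "ennreal (u x * v x) \<le> ennreal (\<alpha> * \<beta> / (a * s)) * ennreal (u x powr s) +
          ennreal (\<alpha> * \<beta> / (b * s')) * ennreal (v x powr s')"
        using pos a b s by (simp add: ennreal_mult[symmetric] ennreal_plus[symmetric] del: ennreal_plus)
    qed
    also have "\<dots> = ennreal (\<alpha> * \<beta> / (a * s)) * ?U + ennreal (\<alpha> * \<beta> / (b * s')) * ?V"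
      by (simp add: nn_integral_add nn_integral_cmult)
    also have "\<dots> = ennreal (\<alpha> * \<beta> / (a * s) * a + \<alpha> * \<beta> / (b * s') * b)"
      using pos a b s by (simp flip: ennreal_mult ennreal_plus)
    also have "\<alpha> * \<beta> / (a * s) * a + \<alpha> * \<beta> / (b * s') * b = \<alpha> * \<beta> * (1 / s + 1 / s')"
      using a b by (simp add: algebra_simps)
    also have "ennreal (\<alpha> * \<beta> * (1 / s + 1 / s')) = ennreal_rpow ?U (1 / s) * ennreal_rpow ?V (1 / s')"
      using a b s(3) by (simp add: \<alpha>_def \<beta>_def ennreal_rpow_ennreal ennreal_mult)
    finally show ?thesis .
  qed
qed

lemma Lp_functional_powr:
  assumes "0 < q" "0 < t"
  shows "Lp_functional \<eta> q (\<lambda>e. u e powr t) = ennreal_rpow (Lp_functional \<eta> (q * t) u) t"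
  using assms by (simp add: Lp_functional_def ennreal_rpow_rpow powr_powr mult.commute)

lemma Lp_functional_cong:
  "(\<And>e. e \<in> space \<eta> \<Longrightarrow> u e = v e) \<Longrightarrow> Lp_functional \<eta> p u = Lp_functional \<eta> p v"
  unfolding Lp_functional_def by (auto cong: nn_integral_cong)

lemma Lp_functional_eq_0_iff:
  "u \<in> borel_measurable \<eta> \<Longrightarrow> Lp_functional \<eta> p u = 0 \<longleftrightarrow> (AE e in \<eta>. u e = 0)"
  by (simp add: Lp_functional_def nn_integral_powr_eq_0_iff)

lemma Lp_functional_finite:
  assumes "emeasure \<eta> (space \<eta>) < \<infinity>" and "0 < p"
    and "\<And>e. e \<in> space \<eta> \<Longrightarrow> 0 \<le> u e \<and> u e \<le> C"
  shows "Lp_functional \<eta> p u < \<infinity>"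
proof -
  have "(\<integral>\<^sup>+ e. ennreal (u e powr p) \<partial>\<eta>) \<le> (\<integral>\<^sup>+ e. ennreal (C powr p) \<partial>\<eta>)"
    using assms by (intro nn_integral_mono) (auto intro!: ennreal_leI powr_mono2)
  also have "\<dots> < top" using assms(1) by (simp add: ennreal_mult_less_top)
  finally show ?thesis by (simp add: Lp_functional_def)
qed

text \<open>Hoelder's inequality for \<open>u powr p\<close> against the constant 1, with first
  exponent \<open>p' / p\<close>. Equal exponents are treated apart, since the conjugate exponent is
  then infinite.\<close>

lemma Lp_functional_mono_exponent:
  assumes [measurable]: "u \<in> borel_measurable \<eta>"
    and fin: "0 < emeasure \<eta> (space \<eta>)" "emeasure \<eta> (space \<eta>) < \<infinity>" and p: "0 < p" "p \<le> p'"
  shows "Lp_functional \<eta> p u \<le>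
    ennreal (measure \<eta> (space \<eta>) powr (1 / p - 1 / p')) * Lp_functional \<eta> p' u"
proof (cases "p = p'")
  case True
  \<comment> \<open>The factor has exponent 0 here, and it equals 1 only for a nonzero base, since
    \<open>0 powr 0 = 0\<close>.\<close>
  have "measure \<eta> (space \<eta>) \<noteq> 0" using fin by (auto simp: measure_def enn2real_eq_0_iff)
  then show ?thesis using True by simp
next
  case False
  define s where "s = p' / p"
  define s' where "s' = p' / (p' - p)"
  have s: "1 < s" "1 < s'" "1 / s + 1 / s' = 1"
    using False p by (simp_all add: s_def s'_def field_simps)
  have "(\<integral>\<^sup>+ e. ennreal (u e powr p) \<partial>\<eta>) = (\<integral>\<^sup>+ e. ennreal (u e powr p * 1) \<partial>\<eta>)" by simp
  also have "\<dots> \<le> ennreal_rpow (\<integral>\<^sup>+ e. ennreal ((u e powr p) powr s) \<partial>\<eta>) (1 / s) *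
      ennreal_rpow (\<integral>\<^sup>+ e. ennreal (1 powr s') \<partial>\<eta>) (1 / s')"
    by (rule nn_integral_Hoelder) (use s in auto)
  finally have "Lp_functional \<eta> p u \<le>
      ennreal_rpow (ennreal_rpow (\<integral>\<^sup>+ e. ennreal ((u e powr p) powr s) \<partial>\<eta>) (1 / s) *
        ennreal_rpow (\<integral>\<^sup>+ e. ennreal (1 powr s') \<partial>\<eta>) (1 / s')) (1 / p)"
    unfolding Lp_functional_def using p by (intro ennreal_rpow_mono) auto
  also have "\<dots> = Lp_functional \<eta> p' u * ennreal_rpow (emeasure \<eta> (space \<eta>)) (1 / s' * (1 / p))"
    using p by (simp add: ennreal_rpow_mult ennreal_rpow_rpow powr_powr Lp_functional_def s_def)
  also have "1 / s' * (1 / p) = 1 / p - 1 / p'"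
    using p False by (simp add: s'_def field_simps)
  also have "emeasure \<eta> (space \<eta>) = ennreal (measure \<eta> (space \<eta>))"
    using fin by (intro emeasure_eq_ennreal_measure) auto
  finally show ?thesis by (simp add: ennreal_rpow_ennreal mult.commute)
qed

text \<open>To be used with \<open>u\<close> and \<open>u'\<close> the extensions of a function and
  of its Mazur image with exponent \<open>t\<close>, and \<open>w\<close> the norm of the function.
  Hoelder's inequality separates \<open>u powr p\<close> from
  \<open>w powr ((t - 1) * p)\<close>.\<close>

lemma Lp_functional_interpolate:
  assumes [measurable]: "u \<in> borel_measurable \<eta>" "w \<in> borel_measurable \<eta>"
    and nonneg: "\<And>e. e \<in> space \<eta> \<Longrightarrow> 0 \<le> u e" "\<And>e. e \<in> space \<eta> \<Longrightarrow> 0 \<le> u' e"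
      "\<And>e. e \<in> space \<eta> \<Longrightarrow> 0 \<le> w e"
    and le: "\<And>e. e \<in> space \<eta> \<Longrightarrow> u' e \<le> t * w e powr (t - 1) * u e"
    and pq: "0 < p" "0 < q" "1 < s" "1 < t" "p * (s / (s - 1)) = q * (t / (t - 1))"
  shows "Lp_functional \<eta> p u' \<le> ennreal t *
    (Lp_functional \<eta> (p * s) u * ennreal_rpow (Lp_functional \<eta> (q * t) w) (t - 1))"
proof -
  define s' where "s' = s / (s - 1)"
  have s: "1 < s" "1 < s'" "1 / s + 1 / s' = 1"
    using pq by (simp_all add: s'_def field_simps)
  \<comment> \<open>The relation between the conjugate exponents is exactly what makes
    \<open>w\<close> appear with the power \<open>q * t\<close>.\<close>
  have "(t - 1) * p * s' = (t - 1) * (p * (s / (s - 1)))" by (simp add: s'_def)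
  also have "\<dots> = q * t" unfolding pq(5) using pq(4) by simp
  finally have e: "(t - 1) * p * s' = q * t" .
  have "(\<integral>\<^sup>+ e. ennreal (u' e powr p) \<partial>\<eta>) \<le>
      (\<integral>\<^sup>+ e. ennreal (t powr p) * ennreal (u e powr p * w e powr ((t - 1) * p)) \<partial>\<eta>)"
  proof (rule nn_integral_mono)
    fix e assume e: "e \<in> space \<eta>"
    have "u' e powr p \<le> (t * w e powr (t - 1) * u e) powr p"
      using e nonneg le pq by (intro powr_mono2) auto
    also have "\<dots> = t powr p * (u e powr p * w e powr ((t - 1) * p))"
      using pq nonneg[OF e] by (simp add: powr_mult powr_powr)
    finally show "ennreal (u' e powr p) \<le>
        ennreal (t powr p) * ennreal (u e powr p * w e powr ((t - 1) * p))"
      by (simp flip: ennreal_mult)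
  qed
  also have "\<dots> = ennreal (t powr p) * (\<integral>\<^sup>+ e. ennreal (u e powr p * w e powr ((t - 1) * p)) \<partial>\<eta>)"
    by (simp add: nn_integral_cmult)
  also have "\<dots> \<le> ennreal (t powr p) *
      (ennreal_rpow (\<integral>\<^sup>+ e. ennreal ((u e powr p) powr s) \<partial>\<eta>) (1 / s) *
       ennreal_rpow (\<integral>\<^sup>+ e. ennreal ((w e powr ((t - 1) * p)) powr s') \<partial>\<eta>) (1 / s'))"
    by (intro mult_left_mono nn_integral_Hoelder) (use s in auto)
  finally have "Lp_functional \<eta> p u' \<le> ennreal_rpow (ennreal (t powr p) *
      (ennreal_rpow (\<integral>\<^sup>+ e. ennreal ((u e powr p) powr s) \<partial>\<eta>) (1 / s) *
       ennreal_rpow (\<integral>\<^sup>+ e. ennreal ((w e powr ((t - 1) * p)) powr s') \<partial>\<eta>) (1 / s'))) (1 / p)"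
    unfolding Lp_functional_def using pq by (intro ennreal_rpow_mono) auto
  also have "\<dots> = ennreal t * (Lp_functional \<eta> (p * s) u *
      ennreal_rpow (\<integral>\<^sup>+ e. ennreal (w e powr (q * t)) \<partial>\<eta>) (1 / s' * (1 / p)))"
    using pq e
    by (simp add: ennreal_rpow_mult ennreal_rpow_rpow ennreal_rpow_ennreal powr_powr
        Lp_functional_def mult.commute)
  \<comment> \<open>In this form the remaining power of the integral is the power
    \<open>t - 1\<close> of the functional with exponent \<open>q * t\<close>.\<close>
  also have "1 / s' * (1 / p) = 1 / (q * t) * (t - 1)"
    unfolding e[symmetric] using pq s by (simp add: field_simps)
  finally show ?thesis by (simp add: Lp_functional_def ennreal_rpow_rpow)
qed

section \<open>Comparison of extension constants\<close>

lemma ext_const_le_mult: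
  assumes k: "0 < k" and T: "\<And>Y. Y \<in> \<Y> \<Longrightarrow> T ` Y \<in> \<Y>"
    and iff: "\<And>f. f \<in> \<Union>\<Y> \<Longrightarrow> 0 < N (T f) \<and> N (T f) < \<infinity> \<longleftrightarrow> 0 < N' f \<and> N' f < \<infinity>"
    and le: "\<And>f. f \<in> \<Union>\<Y> \<Longrightarrow> 0 < N' f \<Longrightarrow> N' f < \<infinity> \<Longrightarrow>
      F (T f) / N (T f) \<le> ennreal k * (F' f / N' f)"
  shows "ext_const \<Y> F N \<le> ennreal k * ext_const \<Y> F' N'"
proof -
  let ?K = "ennreal k"
  \<comment> \<open>Dividing by the constant leaves a bare infimum on the right, so that each
    \<open>Y\<close> can be treated alone; an infimum over no sets is covered as well.\<close>
  have "ext_const \<Y> F N / ?K \<le> ext_const \<Y> F' N'"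
    unfolding ext_const_def[of \<Y> F' N']
  proof (rule INF_greatest)
    fix Y assume "Y \<in> {Y \<in> \<Y>. \<exists>f\<in>Y. 0 < N' f \<and> N' f < \<infinity>}"
    then have Y: "Y \<in> \<Y>" and ex: "\<exists>f\<in>Y. 0 < N' f \<and> N' f < \<infinity>" by auto
    let ?S = "SUP f\<in>{f \<in> Y. 0 < N' f \<and> N' f < \<infinity>}. F' f / N' f"
    have "ext_const \<Y> F N \<le> (SUP f\<in>{f \<in> T ` Y. 0 < N f \<and> N f < \<infinity>}. F f / N f)"
      unfolding ext_const_def using T[OF Y] iff Y ex by (intro INF_lower) blast
    also have "\<dots> \<le> ?K * ?S"
    proof (rule SUP_least)
      fix g assume "g \<in> {f \<in> T ` Y. 0 < N f \<and> N f < \<infinity>}"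
      then obtain f where f: "f \<in> Y" "g = T f" "0 < N' f \<and> N' f < \<infinity>" using iff Y by blast
      then have "F g / N g \<le> ?K * (F' f / N' f)" using le Y by blast
      also have "\<dots> \<le> ?K * ?S" using f by (intro mult_left_mono SUP_upper) auto
      finally show "F g / N g \<le> ?K * ?S" .
    qed
    finally have "ext_const \<Y> F N / ?K \<le> ?K * ?S / ?K" by (rule divide_right_mono_ennreal)
    also have "\<dots> = ?S" using k by (subst mult.commute, subst ennreal_mult_divide_eq) auto
    finally show "ext_const \<Y> F N / ?K \<le> ?S" .
  qed
  then have "?K * (ext_const \<Y> F N / ?K) \<le> ?K * ext_const \<Y> F' N'" by (rule mult_left_mono) simp
  also have "?K * (ext_const \<Y> F N / ?K) = ext_const \<Y> F N"
    using k by (simp add: ennreal_times_divide, subst mult.commute, subst ennreal_mult_divide_eq) auto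
  finally show ?thesis .
qed

section \<open>Abstract families of layer functions\<close>

text \<open>\<open>L f e\<close> is the layer function \<open>t \<mapsto> \<phi>\<^sub>e{f \<ge> t}\<close>, respectively
  \<open>t \<mapsto> \<psi>\<^sub>e({f \<ge> t}, {f \<le> -t})\<close>; \<open>A\<close> is the extension and \<open>B\<close> is the norm.\<close>

locale layer_family =
  fixes M :: "'a measure" and \<eta> :: "'e measure" and \<Y> :: "('a \<Rightarrow> real) set set"
    and L :: "('a \<Rightarrow> real) \<Rightarrow> 'e \<Rightarrow> real \<Rightarrow> real" and A B :: "('a \<Rightarrow> real) \<Rightarrow> 'e \<Rightarrow> real"
  assumes admissible: "admissible M \<Y>"
    and L_nonneg: "f \<in> Bd M \<Longrightarrow> e \<in> space \<eta> \<Longrightarrow> 0 \<le> L f e t"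
    and L_integrable: "f \<in> Bd M \<Longrightarrow> e \<in> space \<eta> \<Longrightarrow> L f e absolutely_integrable_on UNIV"
    and L_vanishes: "f \<in> Bd M \<Longrightarrow>
      \<exists>T>0. \<forall>e\<in>space \<eta>. \<forall>s\<ge>T. L f e s = 0 \<and> L f e (- s) = 0"
    and L_mazur: "1 < r \<Longrightarrow> f \<in> Bd M \<Longrightarrow> e \<in> space \<eta> \<Longrightarrow> L (mazur M r f) e (spow r u) = L f e u"
    and A_eq: "f \<in> Bd M \<Longrightarrow> e \<in> space \<eta> \<Longrightarrow> A f e = integral UNIV (L f e)"
    and B_eq: "f \<in> Bd M \<Longrightarrow> e \<in> space \<eta> \<Longrightarrow> B f e = layer_norm (L f e)"
    and A_measurable: "f \<in> Bd M \<Longrightarrow> A f \<in> borel_measurable \<eta>"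
    and B_measurable: "f \<in> Bd M \<Longrightarrow> B f \<in> borel_measurable \<eta>"
begin

abbreviation "const p q \<equiv>
  ext_const \<Y> (\<lambda>f. Lp_functional \<eta> p (A f)) (\<lambda>f. Lp_functional \<eta> q (B f))"

lemma Bd_of_family: "f \<in> \<Union>\<Y> \<Longrightarrow> f \<in> Bd M"
  using admissible by (auto simp: admissible_def)

text \<open>Read off from admissibility: the Mazur image of a member of the family is again a
  member, hence a subset of \<open>Bd M\<close>.\<close>

lemma mazur_Bd:
  assumes "f \<in> \<Union>\<Y>" "0 < r"
  shows "mazur M r f \<in> Bd M"
proof -
  obtain Y where "Y \<in> \<Y>" "f \<in> Y" using assms(1) by blast
  then have "mazur M r ` Y \<in> \<Y>" using admissible assms(2) by (simp add: admissible_def)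
  then show ?thesis using \<open>f \<in> Y\<close> Bd_of_family by blast
qed

lemma A_nonneg: "f \<in> Bd M \<Longrightarrow> e \<in> space \<eta> \<Longrightarrow> 0 \<le> A f e"
  using L_nonneg set_lebesgue_integral_eq_integral(1)[OF L_integrable]
  by (simp add: A_eq integral_nonneg)

text \<open>The threshold in \<open>L_vanishes\<close> is chosen before \<open>e\<close>, so the
  bound is uniform over the parameter space.\<close>

lemma B_bounded:
  assumes "f \<in> Bd M"
  obtains C where "\<And>e. e \<in> space \<eta> \<Longrightarrow> 0 \<le> B f e \<and> B f e \<le> C"
proof -
  obtain T where "T > 0" "\<forall>e\<in>space \<eta>. \<forall>s\<ge>T. L f e s = 0 \<and> L f e (- s) = 0"
    using L_vanishes[OF assms] by blast
  then have "0 \<le> B f e \<and> B f e \<le> T" if "e \<in> space \<eta>" for e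
    using that layer_norm_nonneg[of T "L f e"] layer_norm_le[of T "L f e"]
    by (simp add: B_eq assms)
  then show thesis by (rule that)
qed

lemma B_nonneg: "f \<in> Bd M \<Longrightarrow> e \<in> space \<eta> \<Longrightarrow> 0 \<le> B f e"
  using B_bounded by blast

lemma
  assumes r: "1 < r" and f: "f \<in> Bd M" "mazur M r f \<in> Bd M" and e: "e \<in> space \<eta>"
  shows A_mazur_le: "A (mazur M r f) e \<le> r * B f e powr (r - 1) * A f e"
    and B_mazur: "B (mazur M r f) e = B f e powr r"
proof -
  obtain T where T: "T > 0" "\<And>s. T \<le> s \<Longrightarrow> L f e s = 0 \<and> L f e (- s) = 0"
    using L_vanishes[OF f(1)] e by blast
  show "A (mazur M r f) e \<le> r * B f e powr (r - 1) * A f e"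
    unfolding A_eq[OF f(1) e] A_eq[OF f(2) e] B_eq[OF f(1) e]
    by (rule integral_layer_spow_le[where T = T])
      (use r L_mazur L_nonneg L_integrable f e T in blast)+
  show "B (mazur M r f) e = B f e powr r"
    unfolding B_eq[OF f(1) e] B_eq[OF f(2) e]
    by (rule layer_norm_spow[where T = T]) (use r L_mazur f e T in blast)+
qed

lemma const_le:
  assumes "1 \<le> p" "1 \<le> q" "1 \<le> s" "1 \<le> t"
    and conj: "ennreal p * hoelder_conj s = ennreal q * hoelder_conj t"
  shows "const p q \<le> ennreal t * const (p * s) (q * t)"
proof (cases "s = 1 \<or> t = 1")
  case True
  \<comment> \<open>The conjugate of 1 is infinite and that of a larger exponent is finite, so
    \<open>conj\<close> forces \<open>s = 1\<close> and \<open>t = 1\<close> together; both sides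
    then coincide.\<close>
  have "ennreal a * ennreal b \<noteq> top" for a b
    by (simp add: ennreal_mult_eq_top_iff)
  from True this this[symmetric] have "s = 1 \<and> t = 1"
    using assms
    by (auto simp: hoelder_conj_def ennreal_mult_top ennreal_top_mult ennreal_mult_eq_top_iff
        split: if_splits)
  then show ?thesis by simp
next
  case False
  then have st: "1 < s" "1 < t" using assms by auto
  have "ennreal (p * (s / (s - 1))) = ennreal (q * (t / (t - 1)))"
    using conj st assms
    by (simp add: hoelder_conj_def ennreal_mult del: times_divide_eq_right)
  then have pq: "p * (s / (s - 1)) = q * (t / (t - 1))"
    by (rule ennreal_inj[THEN iffD1, rotated 2]) (use st assms in auto)
  show ?thesis
  proof (rule ext_const_le_mult[where T = "mazur M t"])
    show "0 < t" using st by simp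
    show "mazur M t ` Y \<in> \<Y>" if "Y \<in> \<Y>" for Y
      using admissible that st by (simp add: admissible_def)
    fix f assume f: "f \<in> \<Union>\<Y>"
    note Bd = Bd_of_family[OF f] mazur_Bd[OF f \<open>0 < t\<close>]
    let ?N = "Lp_functional \<eta> (q * t) (B f)"
    have N: "Lp_functional \<eta> q (B (mazur M t f)) = ennreal_rpow ?N t"
      using st assms
      by (subst Lp_functional_powr[symmetric]) (auto intro!: Lp_functional_cong B_mazur Bd)
    \<comment> \<open>The power \<open>t\<close> changes neither vanishing nor finiteness of the
      bracket.\<close>
    then show "0 < Lp_functional \<eta> q (B (mazur M t f)) \<and>
        Lp_functional \<eta> q (B (mazur M t f)) < \<infinity> \<longleftrightarrow> 0 < ?N \<and> ?N < \<infinity>"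
      by (simp add: zero_less_iff_neq_zero)
    assume fin: "0 < ?N" "?N < \<infinity>"
    then obtain n where n: "?N = ennreal n" "0 < n"
      by (cases ?N) (auto simp: order_le_less)
    let ?F = "Lp_functional \<eta> (p * s) (A f)"
    have "Lp_functional \<eta> p (A (mazur M t f)) \<le> ennreal t * (?F * ennreal_rpow ?N (t - 1))"
      using st assms pq Bd
      by (intro Lp_functional_interpolate)
        (auto intro: A_measurable B_measurable A_nonneg B_nonneg A_mazur_le)
    then have "Lp_functional \<eta> p (A (mazur M t f)) / ennreal_rpow ?N t \<le>
        ennreal t * (?F * ennreal_rpow ?N (t - 1)) / ennreal_rpow ?N t"
      by (rule divide_right_mono_ennreal)
    \<comment> \<open>The bracket of the Mazur image splits as
      \<open>n powr t = n * n powr (t - 1)\<close>; the second factor is positive and finite and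
      cancels.\<close>
    also have "\<dots> = (ennreal t * ?F) * ennreal (n powr (t - 1)) / (ennreal n * ennreal (n powr (t - 1)))"
      using n by (simp add: ennreal_rpow_ennreal mult.assoc powr_mult_base flip: ennreal_mult)
    also have "\<dots> = ennreal t * ?F / ennreal n"
      using n by (intro divide_mult_eq) auto
    finally show "Lp_functional \<eta> p (A (mazur M t f)) / Lp_functional \<eta> q (B (mazur M t f)) \<le>
        ennreal t * (?F / ?N)"
      by (simp add: N n ennreal_times_divide)
  qed
qed

lemma mono_on_diagonal: "mono_on {1..} (\<lambda>p. ennreal p * const p p)"
proof (rule mono_onI)
  fix p p' :: real assume p: "p \<in> {1..}" "p' \<in> {1..}" "p \<le> p'"
  \<comment> \<open>With \<open>q = p\<close> and \<open>s = t = p' / p\<close> the condition on the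
    conjugates is trivial.\<close>
  have "const p p \<le> ennreal (p' / p) * const (p * (p' / p)) (p * (p' / p))"
    using p by (intro const_le) auto
  then have "ennreal p * const p p \<le> ennreal p * (ennreal (p' / p) * const p' p')"
    using p by (intro mult_left_mono) auto
  also have "\<dots> = ennreal p' * const p' p'"
    using p by (simp add: mult.assoc[symmetric] flip: ennreal_mult)
  finally show "ennreal p * const p p \<le> ennreal p' * const p' p'" .
qed

context
  assumes pos: "0 < emeasure \<eta> (space \<eta>)" and fin: "emeasure \<eta> (space \<eta>) < \<infinity>"
begin

lemma total_pos: "0 < measure \<eta> (space \<eta>)"
  using pos fin by (simp add: measure_def enn2real_positive_iff)

text \<open>Only the numerators depend on \<open>p\<close>, so the quotients are compared function
  by function on the same sets \<open>Y\<close>, with the identity in place of a Mazur map.\<close>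

lemma mono_on_extension_exponent:
  "mono_on {1..} (\<lambda>p. ennreal (measure \<eta> (space \<eta>) powr (- 1 / p)) * const p q)"
proof (rule mono_onI)
  fix p p' :: real assume p: "p \<in> {1..}" "p' \<in> {1..}" "p \<le> p'"
  let ?m = "measure \<eta> (space \<eta>)"
  have "const p q \<le> ennreal (?m powr (1 / p - 1 / p')) * const p' q"
  proof (rule ext_const_le_mult[where T = id])
    show "0 < ?m powr (1 / p - 1 / p')" using total_pos by simp
    fix f assume f: "f \<in> \<Union>\<Y>"
    have "Lp_functional \<eta> p (A f) \<le>
        ennreal (?m powr (1 / p - 1 / p')) * Lp_functional \<eta> p' (A f)"
      using p pos fin Bd_of_family[OF f]
      by (intro Lp_functional_mono_exponent) (auto intro: A_measurable)
    then show "Lp_functional \<eta> p (A (id f)) / Lp_functional \<eta> q (B (id f)) \<le>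
        ennreal (?m powr (1 / p - 1 / p')) * (Lp_functional \<eta> p' (A f) / Lp_functional \<eta> q (B f))"
      by (simp add: ennreal_times_divide divide_right_mono_ennreal)
  qed auto
  then have "ennreal (?m powr (- 1 / p)) * const p q \<le>
      ennreal (?m powr (- 1 / p)) * (ennreal (?m powr (1 / p - 1 / p')) * const p' q)"
    by (intro mult_left_mono) auto
  also have "\<dots> = ennreal (?m powr (- 1 / p')) * const p' q"
    by (simp add: mult.assoc[symmetric] flip: ennreal_mult powr_add)
  finally show "ennreal (?m powr (- 1 / p)) * const p q \<le> ennreal (?m powr (- 1 / p')) * const p' q" .
qed

text \<open>The sets discarded in \<open>const p q\<close> do not depend on \<open>q\<close>: the functions \<open>B f\<close> are bounded, so the
  brackets are finite, and they vanish only if \<open>B f = 0\<close> almost everywhere.\<close>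

lemma antimono_on_norm_exponent:
  "antimono_on {1..} (\<lambda>q. ennreal (measure \<eta> (space \<eta>) powr (1 / q)) * const p q)"
proof (rule monotone_onI)
  fix q q' :: real assume q: "q \<in> {1..}" "q' \<in> {1..}" "q \<le> q'"
  let ?m = "measure \<eta> (space \<eta>)"
  have "const p q' \<le> ennreal (?m powr (1 / q - 1 / q')) * const p q"
  proof (rule ext_const_le_mult[where T = id])
    show "0 < ?m powr (1 / q - 1 / q')" using total_pos by simp
    fix f assume "f \<in> \<Union>\<Y>"
    then have f: "f \<in> Bd M" by (rule Bd_of_family)
    let ?N = "\<lambda>q. Lp_functional \<eta> q (B f)"
    obtain C where C: "\<And>e. e \<in> space \<eta> \<Longrightarrow> 0 \<le> B f e \<and> B f e \<le> C"
      using B_bounded[OF f] by blast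
    have fin': "?N r < \<infinity>" if "0 < r" for r
      using fin that C by (rule Lp_functional_finite)
    have iff: "?N r = 0 \<longleftrightarrow> (AE e in \<eta>. B f e = 0)" for r
      using B_measurable[OF f] by (rule Lp_functional_eq_0_iff)
    show "0 < Lp_functional \<eta> q' (B (id f)) \<and> Lp_functional \<eta> q' (B (id f)) < \<infinity> \<longleftrightarrow>
        0 < ?N q \<and> ?N q < \<infinity>"
      using fin'[of q] fin'[of q'] q by (simp add: zero_less_iff_neq_zero iff)
    assume pos': "0 < ?N q"
    then have "0 < ?N q'" using iff by (simp add: zero_less_iff_neq_zero)
    have le: "?N q \<le> ennreal (?m powr (1 / q - 1 / q')) * ?N q'"
      using q pos fin f
      by (intro Lp_functional_mono_exponent) (auto intro: B_measurable)
    obtain a where a: "?N q = ennreal a" "0 < a"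
      using pos' fin'[of q] q by (cases "?N q") (auto simp: order_le_less)
    obtain b where b: "?N q' = ennreal b" "0 < b"
      using \<open>0 < ?N q'\<close> fin'[of q'] q by (cases "?N q'") (auto simp: order_le_less)
    let ?k = "?m powr (1 / q - 1 / q')"
    let ?F = "Lp_functional \<eta> p (A f)"
    \<comment> \<open>The bracket is in the denominator, so its bound is inverted; this is done in
      the reals, both brackets being positive and finite.\<close>
    have "a \<le> ?k * b" using le a b by (simp flip: ennreal_mult)
    then have "1 / b \<le> ?k * (1 / a)" using a b by (simp add: field_simps)
    then have "?F * ennreal (1 / b) \<le> ?F * ennreal (?k * (1 / a))"
      by (intro mult_left_mono ennreal_leI) auto
    also have "\<dots> = ennreal ?k * (?F * ennreal (1 / a))"
      using a by (subst ennreal_mult) (auto simp: mult_ac)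
    finally show "Lp_functional \<eta> p (A (id f)) / Lp_functional \<eta> q' (B (id f)) \<le> ennreal ?k * (?F / ?N q)"
      using a b by (simp add: divide_ennreal_def inverse_ennreal inverse_eq_divide)
  qed auto
  then have "ennreal (?m powr (1 / q')) * const p q' \<le>
      ennreal (?m powr (1 / q')) * (ennreal (?m powr (1 / q - 1 / q')) * const p q)"
    by (intro mult_left_mono) auto
  also have "\<dots> = ennreal (?m powr (1 / q)) * const p q"
    by (simp add: mult.assoc[symmetric] flip: ennreal_mult powr_add)
  finally show "ennreal (?m powr (1 / q')) * const p q' \<le> ennreal (?m powr (1 / q)) * const p q" .
qed

end

lemma extension_constants:
  "(\<forall>p\<ge>1. \<forall>q\<ge>1. \<forall>s\<ge>1. \<forall>t\<ge>1. ennreal p * hoelder_conj s = ennreal q * hoelder_conj t \<longrightarrow>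
      const p q \<le> ennreal t * const (p * s) (q * t)) \<and>
   mono_on {1..} (\<lambda>p. ennreal p * const p p) \<and>
   (0 < emeasure \<eta> (space \<eta>) \<and> emeasure \<eta> (space \<eta>) < \<infinity> \<longrightarrow>
     (\<forall>q\<ge>1. mono_on {1..} (\<lambda>p. ennreal (measure \<eta> (space \<eta>) powr (- 1 / p)) * const p q)) \<and>
     (\<forall>p\<ge>1. antimono_on {1..} (\<lambda>q. ennreal (measure \<eta> (space \<eta>) powr (1 / q)) * const p q)))"
  using const_le mono_on_diagonal mono_on_extension_exponent antimono_on_norm_exponent by blast

end

section \<open>Level sets of bounded functions and of their Mazur images\<close>

lemma superlevel_mazur: "0 < r \<Longrightarrow> superlevel M (mazur M r f) (spow r u) = superlevel M f u"
  using strict_mono_less_eq[OF strict_mono_spow[of r]]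
  by (auto simp: superlevel_def mazur_def spow_def[symmetric])

lemma sublevel_mazur: "0 < r \<Longrightarrow> sublevel M (mazur M r f) (spow r u) = sublevel M f u"
  using strict_mono_less_eq[OF strict_mono_spow[of r]]
  by (auto simp: sublevel_def mazur_def spow_def[symmetric])

lemma superlevel_sets: "f \<in> Bd M \<Longrightarrow> superlevel M f t \<in> sets M"
  unfolding superlevel_def Bd_def by measurable auto

lemma sublevel_sets: "f \<in> Bd M \<Longrightarrow> sublevel M f t \<in> sets M"
  unfolding sublevel_def Bd_def by measurable auto

lemma Bd_levels:
  assumes "f \<in> Bd M"
  obtains T where "0 < T" "\<And>s. T \<le> s \<Longrightarrow> superlevel M f s = {}"
    "\<And>s. T \<le> s \<Longrightarrow> superlevel M f (- s) = space M" "\<And>s. T \<le> s \<Longrightarrow> sublevel M f (- s) = {}"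
proof -
  obtain b where b: "0 < b" "\<And>x. x \<in> space M \<Longrightarrow> \<bar>f x\<bar> \<le> b"
    using assms by (auto simp: Bd_def bounded_pos)
  have b': "- b \<le> f x" "f x \<le> b" if "x \<in> space M" for x
    using b(2)[OF that] by auto
  \<comment> \<open>The value \<open>b\<close> may be attained by \<open>f\<close> or
    \<open>- f\<close>, while all levels from \<open>b + 1\<close> on are strictly beyond the
    range.\<close>
  show thesis
    by (rule that[of "b + 1"]) (use b(1) b' in \<open>fastforce simp: superlevel_def sublevel_def\<close>)+
qed

section \<open>Set functions and set-pair functions as layer families\<close>

text \<open>Below the infimum of \<open>f\<close> the superlevel set is the whole space, where
  \<open>\<phi> e\<close> vanishes. Hence the Choquet integral extends to the whole line, and its
  additional term is 0.\<close>

lemma layer_family_set_function: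
  assumes adm: "admissible M \<Y>" and \<phi>: "set_function_family M \<eta> \<phi>"
  shows "layer_family M \<eta> \<Y> (\<lambda>f e t. \<phi> e (superlevel M f t))
    (\<lambda>f e. choquet M (\<phi> e) f) (\<lambda>f e. set_norm M (\<phi> e) f)"
proof -
  have zero: "\<phi> e (space M) = 0" "\<phi> e {} = 0" if "e \<in> space \<eta>" for e
    using \<phi> that by (auto simp: set_function_family_def)
  have ext: "indicator {Inf (f ` space M)..} t * \<phi> e (superlevel M f t) = \<phi> e (superlevel M f t)"
    if f: "f \<in> Bd M" and e: "e \<in> space \<eta>" for f e t
  proof (cases "Inf (f ` space M) \<le> t")
    case False
    have "bdd_below (f ` space M)"
      using f by (auto simp: Bd_def intro: bounded_imp_bdd_below)
    then have "Inf (f ` space M) \<le> f x" if "x \<in> space M" for x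
      using that by (intro cInf_lower) auto
    then have "superlevel M f t = space M" using False by (fastforce simp: superlevel_def)
    then show ?thesis using zero e by simp
  qed simp
  have int: "(\<lambda>t. \<phi> e (superlevel M f t)) absolutely_integrable_on UNIV"
    if "f \<in> Bd M" "e \<in> space \<eta>" for f e
    using \<phi> that by (simp add: set_function_family_def set_integrable_def ext)
  show ?thesis
  proof
    fix f e assume f: "f \<in> Bd M" and e: "e \<in> space \<eta>"
    have "choquet M (\<phi> e) f = (LINT t:UNIV|lebesgue. \<phi> e (superlevel M f t))"
      using f e zero by (simp add: choquet_def set_lebesgue_integral_def ext)
    then show "choquet M (\<phi> e) f = integral UNIV (\<lambda>t. \<phi> e (superlevel M f t))"
      using set_lebesgue_integral_eq_integral(2)[OF int[OF f e]] by simp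
  next
    fix f assume "f \<in> Bd M"
    then obtain T where "0 < T" "\<And>s. T \<le> s \<Longrightarrow> superlevel M f s = {}"
        "\<And>s. T \<le> s \<Longrightarrow> superlevel M f (- s) = space M"
      by (rule Bd_levels) blast
    then show "\<exists>T>0. \<forall>e\<in>space \<eta>. \<forall>s\<ge>T. \<phi> e (superlevel M f s) = 0 \<and> \<phi> e (superlevel M f (- s)) = 0"
      using zero by (intro exI[of _ T]) auto
  qed (use adm \<phi> int in \<open>auto simp: set_function_family_def superlevel_sets superlevel_mazur
      set_norm_def layer_norm_def\<close>)
qed

text \<open>Continuing the layer function by 0 to nonpositive levels turns the half-line integral
  into one over the line.\<close>

lemma layer_family_set_pair_function:
  assumes adm: "admissible M \<Y>" and \<psi>: "set_pair_function_family M \<eta> \<psi>"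
  shows "layer_family M \<eta> \<Y>
    (\<lambda>f e t. if 0 < t then \<psi> e (superlevel M f t) (sublevel M f (- t)) else 0)
    (\<lambda>f e. pair_ext M (\<psi> e) f) (\<lambda>f e. pair_norm M (\<psi> e) f)"
proof -
  let ?L = "\<lambda>f e t. if 0 < t then \<psi> e (superlevel M f t) (sublevel M f (- t)) else 0"
  have zero: "\<psi> e {} {} = 0" if "e \<in> space \<eta>" for e
    using \<psi> that by (auto simp: set_pair_function_family_def)
  have ext: "indicator {0<..} t * \<psi> e (superlevel M f t) (sublevel M f (- t)) = ?L f e t" for f e t
    by simp
  have int: "?L f e absolutely_integrable_on UNIV" if "f \<in> Bd M" "e \<in> space \<eta>" for f e
    using \<psi> that by (simp add: set_pair_function_family_def set_integrable_def ext)
  show ?thesis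
  proof
    fix f e assume f: "f \<in> Bd M" and e: "e \<in> space \<eta>"
    have "pair_ext M (\<psi> e) f = (LINT t:UNIV|lebesgue. ?L f e t)"
      by (simp add: pair_ext_def set_lebesgue_integral_def ext)
    then show "pair_ext M (\<psi> e) f = integral UNIV (?L f e)"
      using set_lebesgue_integral_eq_integral(2)[OF int[OF f e]] by simp
    show "pair_norm M (\<psi> e) f = layer_norm (?L f e)"
      unfolding pair_norm_def layer_norm_def by (rule arg_cong[where f = Inf]) auto
  next
    fix f assume "f \<in> Bd M"
    then obtain T where "0 < T" "\<And>s. T \<le> s \<Longrightarrow> superlevel M f s = {}"
        "\<And>s. T \<le> s \<Longrightarrow> sublevel M f (- s) = {}"
      by (rule Bd_levels) blast
    then show "\<exists>T>0. \<forall>e\<in>space \<eta>. \<forall>s\<ge>T. ?L f e s = 0 \<and> ?L f e (- s) = 0"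
      using zero by (intro exI[of _ T]) auto
  next
    \<comment> \<open>The cut at level 0 is respected because \<open>spow r\<close> preserves signs;
      by oddness the sublevel at \<open>- spow r u\<close> is the one at
      \<open>spow r (- u)\<close>.\<close>
    fix r :: real and f e u assume "1 < r"
    then show "?L (mazur M r f) e (spow r u) = ?L f e u"
      using superlevel_mazur[of r M f u] sublevel_mazur[of r M f "- u"]
        strict_mono_less[OF strict_mono_spow[of r], of 0 u]
      by (simp del: spow_nonneg add: spow_nonneg[of 0])
  qed (use adm \<psi> int in \<open>auto simp: set_pair_function_family_def superlevel_sets sublevel_sets\<close>)
qed

theorem theorem4p4:
  fixes M :: "'a measure" and \<eta> :: "'e measure"
    and \<Y> :: "('a \<Rightarrow> real) set set"
    and \<phi> :: "'e \<Rightarrow> 'a set \<Rightarrow> real"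
    and \<psi> :: "'e \<Rightarrow> 'a set \<Rightarrow> 'a set \<Rightarrow> real"
  assumes "admissible M \<Y>"
  shows
    "(set_function_family M \<eta> \<phi> \<longrightarrow>
      (\<forall>p\<ge>1. \<forall>q\<ge>1. \<forall>s\<ge>1. \<forall>t\<ge>1.
         ennreal p * hoelder_conj s = ennreal q * hoelder_conj t \<longrightarrow>
         ext_const \<Y> (Phi M \<eta> \<phi> p) (set_bracket M \<eta> \<phi> q)
           \<le> ennreal t * ext_const \<Y> (Phi M \<eta> \<phi> (p * s)) (set_bracket M \<eta> \<phi> (q * t))) \<and>
      mono_on {1..} (\<lambda>p. ennreal p * ext_const \<Y> (Phi M \<eta> \<phi> p) (set_bracket M \<eta> \<phi> p)) \<and>
      (0 < emeasure \<eta> (space \<eta>) \<and> emeasure \<eta> (space \<eta>) < \<infinity> \<longrightarrow>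
         (\<forall>q\<ge>1. mono_on {1..} (\<lambda>p. ennreal (measure \<eta> (space \<eta>) powr (- 1 / p)) *
            ext_const \<Y> (Phi M \<eta> \<phi> p) (set_bracket M \<eta> \<phi> q))) \<and>
         (\<forall>p\<ge>1. antimono_on {1..} (\<lambda>q. ennreal (measure \<eta> (space \<eta>) powr (1 / q)) *
            ext_const \<Y> (Phi M \<eta> \<phi> p) (set_bracket M \<eta> \<phi> q))))) \<and>
     (set_pair_function_family M \<eta> \<psi> \<longrightarrow>
      (\<forall>p\<ge>1. \<forall>q\<ge>1. \<forall>s\<ge>1. \<forall>t\<ge>1.
         ennreal p * hoelder_conj s = ennreal q * hoelder_conj t \<longrightarrow>
         ext_const \<Y> (Psi M \<eta> \<psi> p) (pair_bracket M \<eta> \<psi> q)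
           \<le> ennreal t * ext_const \<Y> (Psi M \<eta> \<psi> (p * s)) (pair_bracket M \<eta> \<psi> (q * t))) \<and>
      mono_on {1..} (\<lambda>p. ennreal p * ext_const \<Y> (Psi M \<eta> \<psi> p) (pair_bracket M \<eta> \<psi> p)) \<and>
      (0 < emeasure \<eta> (space \<eta>) \<and> emeasure \<eta> (space \<eta>) < \<infinity> \<longrightarrow>
         (\<forall>q\<ge>1. mono_on {1..} (\<lambda>p. ennreal (measure \<eta> (space \<eta>) powr (- 1 / p)) *
            ext_const \<Y> (Psi M \<eta> \<psi> p) (pair_bracket M \<eta> \<psi> q))) \<and>
         (\<forall>p\<ge>1. antimono_on {1..} (\<lambda>q. ennreal (measure \<eta> (space \<eta>) powr (1 / q)) *
            ext_const \<Y> (Psi M \<eta> \<psi> p) (pair_bracket M \<eta> \<psi> q)))))"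
  \<comment> \<open>Inside \<open>ext_const\<close> these functionals lack their last argument, so
    they are unfolded as functions of \<open>f\<close> to match \<open>const\<close> of the
    locale.\<close>
  unfolding Phi_def[abs_def] set_bracket_def[abs_def] Psi_def[abs_def] pair_bracket_def[abs_def]
  by (rule conjI; rule impI; rule layer_family.extension_constants)
    (rule layer_family_set_function layer_family_set_pair_function; use assms in simp)+

end
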